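(* Let $G$ be a finite abelian group and let $D\subset G$ be a $(v,k,\lambda)$-difference set with $k-\lambda>1$. Let $Y$ be the $k\times v$ Youden square with rows indexed by $i\in D$, columns indexed by $j\in G$, and entries $Y(i,j)=ij$. Suppose that, for some column $C$ of $Y$, the array $Y^{[C]}$, obtained from $Y$ by deleting the column $C$ and deleting (leaving the cell empty) every occurrence in the remaining columns of a symbol that appears in $C$, is the RL form of a triple array. Then $D$ admits $-1$ as a multiplier.
   Context: Groups are written multiplicatively. A $k$-subset $D$ of a finite group $G$ of order $v$ is a $(v,k,\lambda)$-difference set if every non-identity element of $G$ can be written in exactly $\lambda$ ways as $xy^{-1}$ with $x,y\in D$. For $G$ abelian, $-1$ is a multiplier of $D$ if $D^{(-1)}:=\{x^{-1}:x\in D\}$ equals a translate $Dg=\{xg:x\in D\}$ of $D$ for some $g\in G$. The RL form of a triple array is what one obtains from a triple array by interchanging the roles of columns and symbols. Explicitly, it is an array with some cells possibly empty, with no symbol repeated in any row or column, such that for some constants $\kappa,\lambda_{rr},\lambda_{cc},\lambda_{rc}$: (RTA1) every column has exactly $\kappa$ occupied cells; (RTA2) for any two distinct rows there are exactly $\lambda_{rr}$ columns in which both rows are occupied; (RTA3) every pair of distinct symbols occurs together in exactly $\lambda_{cc}$ columns; (RTA4) for every row $i$, the columns whose cell in row $i$ is occupied together contain every symbol exactly $\lambda_{rc}$ times. For $Y^{[C]}$ the rows are indexed by $D$, the columns by the $v-1$ elements of $G$ other than the index of $C$, and the symbol set is the set of the $v-k$ elements of $G$ not appearing in $C$. *)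

theory Defs
  imports "HOL-Algebra.Coset"
begin

definition difference_set ::
  "('a, 'm) monoid_scheme \<Rightarrow> 'a set \<Rightarrow> nat \<Rightarrow> nat \<Rightarrow> nat \<Rightarrow> bool" where
  "difference_set G D v k l \<longleftrightarrow>
     group G \<and> finite (carrier G) \<and> order G = v \<and>
     D \<subseteq> carrier G \<and> card D = k \<and>
     (\<forall>g \<in> carrier G - {\<one>\<^bsub>G\<^esub>}.
        card {(x, y). x \<in> D \<and> y \<in> D \<and> x \<otimes>\<^bsub>G\<^esub> inv\<^bsub>G\<^esub> y = g} = l)"

definition minus_one_multiplier :: "('a, 'm) monoid_scheme \<Rightarrow> 'a set \<Rightarrow> bool" where
  "minus_one_multiplier G D \<longleftrightarrow> (\<exists>g \<in> carrier G. set_inv\<^bsub>G\<^esub> D = D #>\<^bsub>G\<^esub> g)"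

text \<open>
  Arrays whose cells may be empty; \<open>None\<close> is an empty cell.  The values of
  \<open>entry\<close> outside \<open>row_set \<times> col_set\<close> carry no meaning.
\<close>

record ('r, 'c, 's) partial_array =
  row_set :: "'r set"
  col_set :: "'c set"
  symbol_set :: "'s set"
  entry :: "'r \<Rightarrow> 'c \<Rightarrow> 's option"

definition occupied :: "('r, 'c, 's) partial_array \<Rightarrow> 'r \<Rightarrow> 'c \<Rightarrow> bool" where
  "occupied A i j \<longleftrightarrow> entry A i j \<noteq> None"

definition col_symbols :: "('r, 'c, 's) partial_array \<Rightarrow> 'c \<Rightarrow> 's set" where
  "col_symbols A j = {s. \<exists>i \<in> row_set A. entry A i j = Some s}"

definition is_array :: "('r, 'c, 's) partial_array \<Rightarrow> bool" where
  "is_array A \<longleftrightarrow>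
     finite (row_set A) \<and> finite (col_set A) \<and> finite (symbol_set A) \<and>
     (\<forall>j \<in> col_set A. col_symbols A j \<subseteq> symbol_set A)"

definition no_repeats :: "('r, 'c, 's) partial_array \<Rightarrow> bool" where
  "no_repeats A \<longleftrightarrow>
     (\<forall>i \<in> row_set A. \<forall>j \<in> col_set A. \<forall>j' \<in> col_set A.
        occupied A i j \<and> entry A i j = entry A i j' \<longrightarrow> j = j') \<and>
     (\<forall>j \<in> col_set A. \<forall>i \<in> row_set A. \<forall>i' \<in> row_set A.
        occupied A i j \<and> entry A i j = entry A i' j \<longrightarrow> i = i')"

text \<open>
  The last conjunct counts occurrences, that is cells \<open>(i', j)\<close> holding \<open>s\<close>
  with \<open>j\<close> ranging over the columns whose cell in row \<open>i\<close> is occupied.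
\<close>

definition rl_triple_array :: "('r, 'c, 's) partial_array \<Rightarrow> bool" where
  "rl_triple_array A \<longleftrightarrow>
     is_array A \<and> no_repeats A \<and>
     (\<exists>\<kappa> l_rr l_cc l_rc :: nat.
        (\<forall>j \<in> col_set A. card {i \<in> row_set A. occupied A i j} = \<kappa>) \<and>
        (\<forall>i \<in> row_set A. \<forall>i' \<in> row_set A. i \<noteq> i' \<longrightarrow>
           card {j \<in> col_set A. occupied A i j \<and> occupied A i' j} = l_rr) \<and>
        (\<forall>s \<in> symbol_set A. \<forall>t \<in> symbol_set A. s \<noteq> t \<longrightarrow>
           card {j \<in> col_set A. s \<in> col_symbols A j \<and> t \<in> col_symbols A j} = l_cc) \<and>
        (\<forall>i \<in> row_set A. \<forall>s \<in> symbol_set A.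
           card {(i', j). i' \<in> row_set A \<and> j \<in> col_set A \<and> occupied A i j \<and>
                          entry A i' j = Some s} = l_rc))"

definition youden_square ::
  "('a, 'm) monoid_scheme \<Rightarrow> 'a set \<Rightarrow> ('a, 'a, 'a) partial_array" where
  "youden_square G D =
     \<lparr>row_set = D, col_set = carrier G, symbol_set = carrier G,
      entry = (\<lambda>i j. Some (i \<otimes>\<^bsub>G\<^esub> j))\<rparr>"

text \<open>The array $A^{[C]}$, where \<open>c\<close> is the index of the column $C$ of \<open>A\<close>.\<close>

definition prune_column ::
  "('r, 'c, 's) partial_array \<Rightarrow> 'c \<Rightarrow> ('r, 'c, 's) partial_array" where
  "prune_column A c =
     \<lparr>row_set = row_set A, col_set = col_set A - {c}, symbol_set = symbol_set A - col_symbols A c,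
      entry = (\<lambda>i j. case entry A i j of
                 None \<Rightarrow> None
               | Some s \<Rightarrow> if s \<in> col_symbols A c then None else Some s)\<rparr>"

end

(* Write M g for the number of ways to write g as a product of two elements of D.  Condition (RTA4)
   says that M is constant on the products x y with x in D and y outside D.  An element g is not
   such a product only if g D^(-1) = D, and then -1 is a multiplier.  Otherwise M is constant on G;
   counting the solutions of h f x^(-1) = d in D for fixed h in two ways then gives a value
   k l + (k - l) [h in D] that does not depend on h, so D is empty or all of G. *)

theory Submission
  imports Defs
begin

context group
begin

text \<open>The coefficient of \<open>g\<close> in the square of \<open>D\<close> in the integral
  group ring: a factorization g = y x with both factors in \<open>D\<close> is recorded by its right
  factor x.\<close>

definition product_count :: "'a set \<Rightarrow> 'a \<Rightarrow> nat" where
  "product_count D g = card {x \<in> D. g \<otimes> inv x \<in> D}"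

lemma difference_count:
  assumes "difference_set G D v k l" and "g \<in> carrier G"
  shows "card {(x, y). x \<in> D \<and> y \<in> D \<and> x \<otimes> inv y = g} = (if g = \<one> then k else l)"
proof (cases "g = \<one>")
  case True
  have D: "D \<subseteq> carrier G" "card D = k"
    using assms(1) by (auto simp: difference_set_def)
  have "x \<otimes> inv y = \<one> \<longleftrightarrow> x = y" if "x \<in> D" "y \<in> D" for x y
    using that D(1) by (metis inv_closed inv_inv inv_equality r_inv subsetD)
  then have "{(x, y). x \<in> D \<and> y \<in> D \<and> x \<otimes> inv y = g} = (\<lambda>x. (x, x)) ` D"
    using True by auto
  then show ?thesis
    using True D by (simp add: card_image inj_on_def)
next
  case False
  then show ?thesis
    using assms by (simp add: difference_set_def)
qed

text \<open>In the group ring, D (D D^(-1)) = D ((k - l) 1 + l G) = (k - l) D + k l G, and both sums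
  are the coefficient of \<open>h\<close> in it. The left one evaluates D D first, the right one D
  D^(-1). No commutativity enters.\<close>

lemma sum_product_count:
  assumes ds: "difference_set G D v k l" and h: "h \<in> carrier G"
  shows "(\<Sum>f\<in>D. product_count D (h \<otimes> f)) = (\<Sum>d\<in>D. if d = h then k else l)"
proof -
  have D: "D \<subseteq> carrier G" and fin: "finite D"
    using ds by (auto simp: difference_set_def intro: finite_subset)
  let ?A = "SIGMA f:D. {x \<in> D. h \<otimes> f \<otimes> inv x \<in> D}"
  let ?B = "SIGMA d:D. {(f, x). f \<in> D \<and> x \<in> D \<and> f \<otimes> inv x = inv h \<otimes> d}"
  have move: "f \<otimes> inv x = inv h \<otimes> d \<longleftrightarrow> h \<otimes> f \<otimes> inv x = d"
    if "f \<in> D" "x \<in> D" "d \<in> D" for f x d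
  proof -
    have "f \<in> carrier G" "inv x \<in> carrier G" "d \<in> carrier G"
      using that D by auto
    then show ?thesis
      using h inv_solve_left[of "f \<otimes> inv x" h d] by (simp add: m_assoc eq_commute)
  qed
  \<comment> \<open>In both sets d, f and x are tied by h f x^(-1) = d. \<open>?A\<close> leaves d
    implicit, so \<open>snd\<close>, which drops d, is the inverse map.\<close>
  have "bij_betw (\<lambda>(f, x). (h \<otimes> f \<otimes> inv x, f, x)) ?A ?B"
    by (rule bij_betw_byWitness[where f' = snd]) (auto simp: move)
  then have "card ?A = card ?B"
    by (rule bij_betw_same_card)
  moreover have "card ?A = (\<Sum>f\<in>D. product_count D (h \<otimes> f))"
    using fin by (simp add: product_count_def)
  moreover have "card ?B = (\<Sum>d\<in>D. if d = h then k else l)"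
  proof -
    have "card ?B = (\<Sum>d\<in>D. card {(f, x). f \<in> D \<and> x \<in> D \<and> f \<otimes> inv x = inv h \<otimes> d})"
      by (intro card_SigmaI fin ballI finite_subset[OF _ finite_cartesian_product[OF fin fin]]) auto
    also have "\<dots> = (\<Sum>d\<in>D. if d = h then k else l)"
    proof (rule sum.cong[OF refl])
      fix d assume "d \<in> D"
      then have d: "d \<in> carrier G" using D by auto
      \<comment> \<open>The single d = h asks for the difference \<open>\<one>\<close>, which has
        the k diagonal representations instead of l.\<close>
      then have "inv h \<otimes> d = \<one> \<longleftrightarrow> d = h"
        using h by (metis inv_closed inv_solve_left' one_closed r_one)
      then show "card {(f, x). f \<in> D \<and> x \<in> D \<and> f \<otimes> inv x = inv h \<otimes> d} = (if d = h then k else l)"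
        using difference_count[OF ds, of "inv h \<otimes> d"] d h by simp
    qed
    finally show ?thesis .
  qed
  ultimately show ?thesis by simp
qed

text \<open>The weighted count \<open>sum_product_count\<close> would be k m at every point, yet it
  is larger by k - l at a point of \<open>D\<close> than at a point outside. The inequality k > l
  also makes \<open>D\<close> nonempty, so both kinds of point exist.\<close>

lemma product_count_not_constant:
  assumes ds: "difference_set G D v k l" and kl: "k > l" and ne: "D \<noteq> carrier G"
  shows "\<not> (\<forall>g \<in> carrier G. product_count D g = m)"
proof
  assume const: "\<forall>g \<in> carrier G. product_count D g = m"
  have D: "D \<subseteq> carrier G" "card D = k" and fin: "finite D"
    using ds by (auto simp: difference_set_def intro: finite_subset)
  obtain d where d: "d \<in> D"
    using D kl by fastforce
  obtain h where h: "h \<in> carrier G" "h \<notin> D"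
    using ne D by auto
  have "(\<Sum>f\<in>D. product_count D (g \<otimes> f)) = k * m" if "g \<in> carrier G" for g
  proof -
    have "(\<Sum>f\<in>D. product_count D (g \<otimes> f)) = (\<Sum>f\<in>D. m)"
      using const that D by (intro sum.cong) auto
    then show ?thesis using D by simp
  qed
  then have "(\<Sum>x\<in>D. if x = d then k else l) = (\<Sum>x\<in>D. if x = h then k else l)"
    using sum_product_count[OF ds] d h D by (metis subsetD)
  also have "\<dots> = (\<Sum>x\<in>D. l)"
    using h by (intro sum.cong) auto
  finally have "(\<Sum>x\<in>D. if x = d then k else l) = (\<Sum>x\<in>D. l)" .
  moreover have "(\<Sum>x\<in>D. l) < (\<Sum>x\<in>D. if x = d then k else l)"
    using fin d kl by (intro sum_strict_mono_ex1) auto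
  ultimately show False by simp
qed

end

text \<open>The map x -> g x^(-1) is injective, so on the finite set \<open>D\<close> mere inclusion
  of the image in \<open>D\<close> forces g D^(-1) = D. By commutativity D^(-1) is then the
  translate of \<open>D\<close> by \<open>inv g\<close>.\<close>

lemma (in comm_group) minus_one_multiplierI:
  assumes fin: "finite D" and D: "D \<subseteq> carrier G" and g: "g \<in> carrier G"
    and closed: "\<And>x. x \<in> D \<Longrightarrow> g \<otimes> inv x \<in> D"
  shows "minus_one_multiplier G D"
proof -
  have "inj_on (\<lambda>x. g \<otimes> inv x) D"
  proof (rule inj_onI)
    fix x y assume "x \<in> D" "y \<in> D" "g \<otimes> inv x = g \<otimes> inv y"
    then show "x = y"
      using D g by (metis inv_closed inv_inv Units_eq Units_l_cancel subsetD)
  qed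
  moreover have "(\<lambda>x. g \<otimes> inv x) ` D \<subseteq> D"
    using closed by auto
  ultimately have img: "(\<lambda>x. g \<otimes> inv x) ` D = D"
    using fin by (simp add: endo_inj_surj)
  have "D #> inv g = (\<lambda>y. y \<otimes> inv g) ` (\<lambda>x. g \<otimes> inv x) ` D"
    unfolding img by (auto simp: r_coset_def)
  also have "\<dots> = (\<lambda>x. inv x) ` D"
    unfolding image_image
  proof (rule image_cong[OF refl])
    fix x assume "x \<in> D"
    then have "x \<in> carrier G" using D by auto
    then show "g \<otimes> inv x \<otimes> inv g = inv x"
      using g by (metis inv_closed inv_solve_right m_closed m_comm)
  qed
  also have "\<dots> = set_inv D"
    by (auto simp: SET_INV_def)
  finally show ?thesis
    unfolding minus_one_multiplier_def using g by (metis inv_closed)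
qed

text \<open>The surviving symbols are the products y c with y outside \<open>D\<close>. In row i
  such a symbol sits in column y i^(-1) c, and the cell of row x in that column survives iff x y
  i^(-1) is not in \<open>D\<close>. Hence the count in (RTA4) is k minus the number of ways to
  write x y as a product of two elements of \<open>D\<close>.\<close>

lemma (in comm_group) pruned_youden_product_count:
  assumes fin: "finite D" and D: "D \<subseteq> carrier G" and c: "c \<in> carrier G"
    and rl: "rl_triple_array (prune_column (youden_square G D) c)"
  obtains m where
    "\<And>x y. x \<in> D \<Longrightarrow> y \<in> carrier G \<Longrightarrow> y \<notin> D \<Longrightarrow> product_count D (x \<otimes> y) = m"
proof -
  let ?A = "prune_column (youden_square G D) c"
  have col: "col_symbols (youden_square G D) c = (\<lambda>i. i \<otimes> c) ` D"
    by (auto simp: youden_square_def col_symbols_def)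
  have A: "row_set ?A = D" "col_set ?A = carrier G - {c}"
      "symbol_set ?A = carrier G - (\<lambda>i. i \<otimes> c) ` D"
    unfolding prune_column_def col by (simp_all add: youden_square_def)
  have entry: "entry ?A i j = (if i \<otimes> j \<in> (\<lambda>i. i \<otimes> c) ` D then None else Some (i \<otimes> j))" for i j
    unfolding prune_column_def col by (simp add: youden_square_def)
  from rl obtain r where r: "\<And>i s. i \<in> D \<Longrightarrow> s \<in> carrier G - (\<lambda>i. i \<otimes> c) ` D \<Longrightarrow>
      card {(i', j). i' \<in> D \<and> j \<in> carrier G - {c} \<and> occupied ?A i j \<and> entry ?A i' j = Some s} = r"
    unfolding rl_triple_array_def A by blast
  \<comment> \<open>Here \<open>r\<close> is the constant \<open>l_rc\<close>. The subtraction does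
    not truncate, since \<open>r\<close> counts a subset of the rows.\<close>
  have "product_count D (x \<otimes> y) = card D - r"
    if x: "x \<in> D" and y: "y \<in> carrier G" "y \<notin> D" for x y
  proof -
    let ?s = "y \<otimes> c"
    have xG: "x \<in> carrier G" using x D by auto
    have mem: "z \<otimes> c \<in> (\<lambda>i. i \<otimes> c) ` D \<longleftrightarrow> z \<in> D" if "z \<in> carrier G" for z
      using that D c by (auto simp: subset_iff)
    have s: "?s \<in> carrier G - (\<lambda>i. i \<otimes> c) ` D"
      using mem[OF y(1)] y c by simp
    have solve: "i \<otimes> j = ?s \<longleftrightarrow> j = y \<otimes> inv i \<otimes> c"
      if "i \<in> carrier G" "j \<in> carrier G" for i j
      using that y c inv_solve_left[of j i "y \<otimes> c"]
      by (auto simp: m_assoc m_lcomm)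
    have occ: "occupied ?A x (y \<otimes> inv i \<otimes> c) \<longleftrightarrow> x \<otimes> y \<otimes> inv i \<notin> D"
      if "i \<in> carrier G" for i
    proof -
      have "x \<otimes> (y \<otimes> inv i \<otimes> c) = x \<otimes> y \<otimes> inv i \<otimes> c"
        using that xG y c by (simp add: m_assoc)
      then show ?thesis
        using mem[of "x \<otimes> y \<otimes> inv i"] that xG y by (simp add: occupied_def entry)
    qed
    \<comment> \<open>The set in (RTA4) ranges over columns other than \<open>c\<close>. The formula
      for \<open>entry\<close> leaves column \<open>c\<close> empty in every row of
      \<open>D\<close>, so an occupied cell in row x automatically lies in another column.\<close>
    have empty: "\<not> occupied ?A x c"
      using x by (simp add: occupied_def entry)
    have entry_s: "entry ?A i j = Some ?s \<longleftrightarrow> i \<otimes> j = ?s" for i j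
      using s by (auto simp: entry)
    let ?B = "{x' \<in> D. x \<otimes> y \<otimes> inv x' \<notin> D}"
    let ?S = "{(i', j). i' \<in> D \<and> j \<in> carrier G - {c} \<and> occupied ?A x j \<and> entry ?A i' j = Some ?s}"
    have "?S = (\<lambda>i. (i, y \<otimes> inv i \<otimes> c)) ` ?B"
    proof (intro equalityI subsetI)
      fix p assume "p \<in> ?S"
      then obtain i j where p: "p = (i, j)" "i \<in> D" "j \<in> carrier G" "occupied ?A x j"
          "i \<otimes> j = ?s"
        unfolding entry_s by auto
      with D have "i \<in> carrier G" by auto
      with p show "p \<in> (\<lambda>i. (i, y \<otimes> inv i \<otimes> c)) ` ?B"
        using solve[of i j] occ[of i] by auto
    next
      fix p assume "p \<in> (\<lambda>i. (i, y \<otimes> inv i \<otimes> c)) ` ?B"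
      then obtain i where i: "p = (i, y \<otimes> inv i \<otimes> c)" "i \<in> D" "x \<otimes> y \<otimes> inv i \<notin> D"
        by auto
      with D have iG: "i \<in> carrier G" by auto
      then have jG: "y \<otimes> inv i \<otimes> c \<in> carrier G" using y c by simp
      have o: "occupied ?A x (y \<otimes> inv i \<otimes> c)" using occ[OF iG] i by simp
      then have "y \<otimes> inv i \<otimes> c \<noteq> c" using empty by metis
      with o i jG show "p \<in> ?S"
        unfolding entry_s using solve[OF iG jG] by simp
    qed
    then have "card ?B = card ?S"
      by (simp add: card_image inj_on_def)
    then have "card ?B = r"
      using r[OF x s] by simp
    moreover have "card D = card ?B + product_count D (x \<otimes> y)"
      unfolding product_count_def using fin
      by (subst card_Un_disjoint[symmetric]) (auto intro: arg_cong[where f = card])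
    ultimately show ?thesis by simp
  qed
  then show thesis by (rule that)
qed

theorem theorem3p7:
  fixes G :: "('a, 'm) monoid_scheme" and D :: "'a set" and v k l :: nat and c :: 'a
  assumes "comm_group G" and "finite (carrier G)"
    and "difference_set G D v k l"
    and "k - l > 1"
    and "c \<in> col_set (youden_square G D)"
    and "rl_triple_array (prune_column (youden_square G D) c)"
  shows "minus_one_multiplier G D"
proof -
  interpret comm_group G by fact
  have D: "D \<subseteq> carrier G" and fin: "finite D"
    using assms(2,3) by (auto simp: difference_set_def intro: finite_subset)
  have c: "c \<in> carrier G"
    using assms(5) by (simp add: youden_square_def)
  obtain m where m:
    "\<And>x y. x \<in> D \<Longrightarrow> y \<in> carrier G \<Longrightarrow> y \<notin> D \<Longrightarrow> product_count D (x \<otimes>\<^bsub>G\<^esub> y) = m"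
    using pruned_youden_product_count[OF fin D c assms(6)] by metis
  show ?thesis
  proof (rule ccontr)
    assume no: "\<not> minus_one_multiplier G D"
    have "product_count D g = m" if g: "g \<in> carrier G" for g
    proof -
      \<comment> \<open>If no such x existed, g D^(-1) would lie in \<open>D\<close>. With it, g = x
        (g x^(-1)) has its first factor in \<open>D\<close> and its second outside.\<close>
      obtain x where x: "x \<in> D" "g \<otimes>\<^bsub>G\<^esub> inv\<^bsub>G\<^esub> x \<notin> D"
        using minus_one_multiplierI[OF fin D g] no by blast
      have xG: "x \<in> carrier G" using x D by auto
      then have "x \<otimes>\<^bsub>G\<^esub> (g \<otimes>\<^bsub>G\<^esub> inv\<^bsub>G\<^esub> x) = g"
        using g by (metis inv_closed inv_solve_right m_closed m_comm)
      then show ?thesis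
        using m[OF x(1) _ x(2)] g xG by simp
    qed
    \<comment> \<open>The whole group is closed under inversion, so g = \<open>\<one>\<close> would
      witness the multiplier.\<close>
    moreover have "D \<noteq> carrier G"
      using minus_one_multiplierI[OF fin D one_closed] no by auto
    moreover have "k > l"
      using assms(4) by simp
    ultimately show False
      using product_count_not_constant[OF assms(3)] by blast
  qed
qed

end
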